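(* Let $(\mathcal{S},s,\mu)$ be a probability space, let $K\subset\mathbb{R}^{m\times n}$ be a proper cone, let $\Omega$ be a convex subset of a Banach space $W$, and let $F:\Omega\to\mathbb{R}^{m\times n}$ be a Fréchet-differentiable strictly $K$-convex function. Let $X:\mathcal{S}\to\Omega$ be a random variable with $\mathbb{E}[\|X\|]<\infty$ and $\mathbb{E}[\|F(X)\|]<\infty$, and let $s_1\subset s$ be a sub-$\sigma$-algebra. Then, over $s_1$-measurable random variables $Y$ (with values in $\Omega$), $$\arg\min_Y\mathbb{E}[D_F(X,Y)]=\mathbb{E}[X|s_1],$$ where the minimization is interpreted in the sense of the partial ordering $\preceq_K$, i.e.: if there exists an $s_1$-measurable $Y'$ such that $\mathbb{E}[D_F(X,Y')]\preceq_K\mathbb{E}\big[D_F(X,\mathbb{E}[X|s_1])\big]$, then $Y'=\mathbb{E}[X|s_1]$ (almost surely).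
   Context: A proper cone $K\subset\mathbb{R}^{m\times n}$ is a cone that is convex, closed, pointed and has non-empty interior; $x\preceq_K y\iff y-x\in K$ and $x\prec_K y\iff y-x\in\mathrm{int}(K)$. $F$ is strictly $K$-convex if $F(\theta x+(1-\theta)y)\prec_K\theta F(x)+(1-\theta)F(y)$ for all $x\ne y$ in $\Omega$ and $\theta\in(0,1)$. $F$ is Fréchet differentiable at $x\in\Omega$ if there is a bounded linear operator $DF(x)(\cdot):W\to\mathbb{R}^{m\times n}$ such that $\|F(x+h)-F(x)-DF(x)(h)\|/\|h\|_W\to0$ as $\|h\|_W\to0$ (with $x+h\in\Omega$). The generalized Bregman divergence between $x,y\in\Omega$ is $D_F(x,y):=F(x)-F(y)-DF(y)(x-y)\in\mathbb{R}^{m\times n}$. Expectations are with respect to $\mu$; the expectations of divergences appearing in the claim are assumed to be defined, and random variables in the second argument of $D_F$ (including $\mathbb{E}[X|s_1]$) are taken to be $\Omega$-valued, as needed for $D_F$ to make sense. *)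

theory Defs
  imports "HOL-Probability.Probability"
begin

section \<open>Proper cones and the partial order they induce\<close>

definition proper_cone :: "'a::euclidean_space set \<Rightarrow> bool" where
  "proper_cone K \<longleftrightarrow> cone K \<and> convex K \<and> closed K \<and>
     (\<forall>x. x \<in> K \<and> - x \<in> K \<longrightarrow> x = 0) \<and> interior K \<noteq> {}"

definition cone_le :: "'a::euclidean_space set \<Rightarrow> 'a \<Rightarrow> 'a \<Rightarrow> bool" where
  "cone_le K x y \<longleftrightarrow> y - x \<in> K"

definition cone_less :: "'a::euclidean_space set \<Rightarrow> 'a \<Rightarrow> 'a \<Rightarrow> bool" where
  "cone_less K x y \<longleftrightarrow> y - x \<in> interior K"

definition strictly_cone_convex_on ::
  "'w::real_vector set \<Rightarrow> 'a::euclidean_space set \<Rightarrow> ('w \<Rightarrow> 'a) \<Rightarrow> bool" where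
  "strictly_cone_convex_on \<Omega> K F \<longleftrightarrow>
     (\<forall>x\<in>\<Omega>. \<forall>y\<in>\<Omega>. \<forall>\<theta>. x \<noteq> y \<and> 0 < \<theta> \<and> \<theta> < 1 \<longrightarrow>
        cone_less K (F (\<theta> *\<^sub>R x + (1 - \<theta>) *\<^sub>R y)) (\<theta> *\<^sub>R F x + (1 - \<theta>) *\<^sub>R F y))"

text \<open>The second argument is a derivative of the first: \<open>DF y\<close> is the linear map \<open>DF(y)(\<cdot>)\<close>.\<close>

definition bregman_div ::
  "('w::real_vector \<Rightarrow> 'a::real_vector) \<Rightarrow> ('w \<Rightarrow> 'w \<Rightarrow> 'a) \<Rightarrow> 'w \<Rightarrow> 'w \<Rightarrow> 'a" where
  "bregman_div F DF x y = F x - F y - DF y (x - y)"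

section \<open>Random variables and conditional expectations in a general Banach space\<close>

text \<open>
  The Bochner integral of \<^theory>\<open>HOL-Analysis.Bochner_Integration\<close> is restricted to second
  countable, hence separable, spaces. The notions below drop this restriction. As usual for
  non-separable ranges, measurability is strong measurability; the two lemmas show that on second
  countable spaces the library's notions are recovered.
\<close>

definition strongly_measurable :: "'a measure \<Rightarrow> ('a \<Rightarrow> 'b::topological_space) \<Rightarrow> bool" where
  "strongly_measurable M f \<longleftrightarrow>
     (\<exists>s. (\<forall>i::nat. simple_function M (s i)) \<and> (\<forall>x\<in>space M. (\<lambda>i. s i x) \<longlonglongrightarrow> f x))"

lemma strongly_measurable_iff_borel_measurable:
  fixes f :: "'a \<Rightarrow> 'b::{metric_space, second_countable_topology}"
  shows "strongly_measurable M f \<longleftrightarrow> f \<in> borel_measurable M"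
proof
  assume "strongly_measurable M f"
  then obtain s where s: "\<And>i::nat. simple_function M (s i)"
    "\<And>x. x \<in> space M \<Longrightarrow> (\<lambda>i. s i x) \<longlonglongrightarrow> f x"
    unfolding strongly_measurable_def by blast
  show "f \<in> borel_measurable M"
    by (rule borel_measurable_LIMSEQ_metric[OF borel_measurable_simple_function[OF s(1)] s(2)])
next
  assume "f \<in> borel_measurable M"
  from borel_measurable_implies_sequence_metric[OF this, of undefined]
  show "strongly_measurable M f"
    unfolding strongly_measurable_def by blast
qed

definition has_strong_bochner_integral ::
  "'a measure \<Rightarrow> ('a \<Rightarrow> 'b::real_normed_vector) \<Rightarrow> 'b \<Rightarrow> bool" where
  "has_strong_bochner_integral M f v \<longleftrightarrow>
     strongly_measurable M f \<and>
     (\<exists>s. (\<forall>i::nat. Bochner_Integration.simple_bochner_integrable M (s i)) \<and>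
          (\<lambda>i. \<integral>\<^sup>+x. norm (f x - s i x) \<partial>M) \<longlonglongrightarrow> 0 \<and>
          (\<lambda>i. Bochner_Integration.simple_bochner_integral M (s i)) \<longlonglongrightarrow> v)"

lemma has_strong_bochner_integral_iff_has_bochner_integral:
  fixes f :: "'a \<Rightarrow> 'b::{real_normed_vector, second_countable_topology}"
  shows "has_strong_bochner_integral M f v \<longleftrightarrow> has_bochner_integral M f v"
  unfolding has_strong_bochner_integral_def strongly_measurable_iff_borel_measurable
    has_bochner_integral.simps by blast

text \<open>
  \<open>Z\<close> is a version of \<open>E[X|N]\<close>. Taking \<open>A = space N\<close> shows that \<open>X\<close> and \<open>Z\<close> are Bochner
  integrable.
\<close>

definition is_cond_exp ::
  "'a measure \<Rightarrow> 'a measure \<Rightarrow> ('a \<Rightarrow> 'b::real_normed_vector) \<Rightarrow> ('a \<Rightarrow> 'b) \<Rightarrow> bool" where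
  "is_cond_exp M N X Z \<longleftrightarrow>
     strongly_measurable N Z \<and>
     (\<forall>A\<in>sets N. \<exists>v.
        has_strong_bochner_integral M (\<lambda>\<omega>. indicator A \<omega> *\<^sub>R X \<omega>) v \<and>
        has_strong_bochner_integral M (\<lambda>\<omega>. indicator A \<omega> *\<^sub>R Z \<omega>) v)"

end

theory Submission
  imports Defs
begin

text \<open>
  A nonzero functional \<open>a\<close> that is nonnegative on \<open>K\<close> is positive on the interior of \<open>K\<close>, so
  \<open>f = a \<bullet> F\<close> is strictly convex and the comparison of the two expectations becomes one of real
  numbers. Subtracting the tangents of \<open>f\<close> at \<open>Y\<close> from those at \<open>Z\<close> gives random affine
  functions \<open>L\<close>, measurable with respect to the sub-\<open>\<sigma>\<close>-algebra, such that
  \<open>L(X) = D_f(X,Y) - D_f(X,Z)\<close> and \<open>L(Z) = D_f(Z,Y) \<ge> 0\<close>, with equality only where \<open>Y = Z\<close>.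
  It remains to replace \<open>X\<close> by its conditional expectation \<open>Z\<close> in the integral of \<open>L(X)\<close>. For a
  deterministic continuous affine function this is the defining property of \<open>Z\<close>. In general \<open>L\<close> is a
  pointwise limit of functions with finitely many values of this kind, on each set of an increasing
  sequence on which \<open>L\<close> is uniformly Lipschitz. Separability of the ranges of \<open>X\<close> and \<open>Z\<close> makes these
  sets measurable and the approximation possible. On these sets the integrals of \<open>L(Z) \<ge> 0\<close>
  increase to that of \<open>L(X)\<close>, which is at most \<open>0\<close>, so \<open>L(Z) = 0\<close> almost everywhere.
\<close>

section \<open>Strong measurability, strong Bochner integrals and bounded linear maps\<close>

lemma strongly_measurable_imp_borel_measurable:
  fixes f :: "'a \<Rightarrow> 'b::metric_space"
  assumes "strongly_measurable M f"
  shows "f \<in> borel_measurable M"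
  using assms unfolding strongly_measurable_def
  by (metis borel_measurable_LIMSEQ_metric borel_measurable_simple_function)

text \<open>The images under \<open>T\<close> of simple functions approximating \<open>f\<close>
  approximate \<open>T (f x)\<close>, the error in the mean growing at most by the operator bound
  \<open>C\<close>. This leads from a possibly non-separable space back to the usual Bochner
  integral, here for real functionals.\<close>

lemma has_strong_bochner_integral_bounded_linear:
  fixes T :: "'b::real_normed_vector \<Rightarrow> 'c::{real_normed_vector, second_countable_topology}"
  assumes "bounded_linear T" and "has_strong_bochner_integral M f v"
  shows "has_bochner_integral M (\<lambda>x. T (f x)) (T v)"
proof -
  interpret T: bounded_linear T by fact
  have sm: "strongly_measurable M f"
    using assms(2) by (simp add: has_strong_bochner_integral_def)
  obtain s where s: "\<And>i::nat. Bochner_Integration.simple_bochner_integrable M (s i)"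
    and lim0: "(\<lambda>i. \<integral>\<^sup>+x. norm (f x - s i x) \<partial>M) \<longlonglongrightarrow> 0"
    and limv: "(\<lambda>i. Bochner_Integration.simple_bochner_integral M (s i)) \<longlonglongrightarrow> v"
    using assms(2) by (auto simp: has_strong_bochner_integral_def)
  obtain u where u: "\<And>i::nat. simple_function M (u i)"
    "\<And>x. x \<in> space M \<Longrightarrow> (\<lambda>i. u i x) \<longlonglongrightarrow> f x"
    using sm by (auto simp: strongly_measurable_def)
  have simple: "simple_function M (s i)" for i
    using s[of i] by (rule Bochner_Integration.simple_bochner_integrable.cases)
  \<comment> \<open>In a non-separable space a difference of Borel functions need not be Borel. Here
    the norm of the difference is a pointwise limit of real simple functions.\<close>
  have meas: "(\<lambda>x. norm (f x - s i x)) \<in> borel_measurable M" for i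
  proof (rule borel_measurable_LIMSEQ_metric)
    show "(\<lambda>x. norm (u j x - s i x)) \<in> borel_measurable M" for j
      by (intro borel_measurable_simple_function
            simple_function_compose2[OF u(1) simple, where h="\<lambda>a b. norm (a - b)"])
    show "(\<lambda>j. norm (u j x - s i x)) \<longlonglongrightarrow> norm (f x - s i x)" if "x \<in> space M" for x
      by (intro tendsto_intros u(2) that)
  qed
  obtain C where C: "C > 0" "\<And>x. norm (T x) \<le> norm x * C"
    using T.pos_bounded by blast
  show ?thesis
  proof (rule has_bochner_integral.intros)
    show "(\<lambda>x. T (f x)) \<in> borel_measurable M"
      by (rule measurable_compose[OF strongly_measurable_imp_borel_measurable[OF sm]
            borel_measurable_continuous_onI[OF T.continuous_on[OF continuous_on_id]]])
    show "Bochner_Integration.simple_bochner_integrable M (\<lambda>x. T (s i x))" for i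
      \<comment> \<open>The rule composes with a function of two arguments; the chosen one ignores
        its second.\<close>
      by (rule Bochner_Integration.simple_bochner_integrable_compose2[OF _ s s, of "\<lambda>a b. T a"])
        (simp add: T.zero)
    show "(\<lambda>i. \<integral>\<^sup>+x. norm (T (f x) - T (s i x)) \<partial>M) \<longlonglongrightarrow> 0"
    proof (rule tendsto_sandwich[OF _ _ tendsto_const])
      show "(\<lambda>i. ennreal C * (\<integral>\<^sup>+x. norm (f x - s i x) \<partial>M)) \<longlonglongrightarrow> 0"
        using ennreal_tendsto_cmult[OF _ lim0, of C] by simp
      have "(\<integral>\<^sup>+x. norm (T (f x) - T (s i x)) \<partial>M) \<le> ennreal C * (\<integral>\<^sup>+x. norm (f x - s i x) \<partial>M)"
        for i
      proof -
        have "(\<integral>\<^sup>+x. norm (T (f x) - T (s i x)) \<partial>M) \<le> (\<integral>\<^sup>+x. ennreal C * norm (f x - s i x) \<partial>M)"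
          using C by (intro nn_integral_mono)
            (auto simp: ac_simps ennreal_mult[symmetric] simp flip: T.diff)
        also have "\<dots> = ennreal C * (\<integral>\<^sup>+x. norm (f x - s i x) \<partial>M)"
          using meas by (intro nn_integral_cmult) simp
        finally show ?thesis .
      qed
      then show "\<forall>\<^sub>F i in sequentially. (\<integral>\<^sup>+x. norm (T (f x) - T (s i x)) \<partial>M)
          \<le> ennreal C * (\<integral>\<^sup>+x. norm (f x - s i x) \<partial>M)"
        by simp
    qed simp
    show "(\<lambda>i. Bochner_Integration.simple_bochner_integral M (\<lambda>x. T (s i x))) \<longlonglongrightarrow> T v"
      using T.tendsto[OF limv]
      by (simp add: Bochner_Integration.simple_bochner_integral_linear[OF T.linear_axioms s])
  qed
qed

text \<open>Applying \<open>T\<close> to the common integral of \<open>X\<close> and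
  \<open>Z\<close> over \<open>A\<close> settles the linear part. The constant \<open>b\<close>
  contributes the same to both sides and is integrable because the measure is finite.\<close>

lemma is_cond_exp_has_bochner_integral_affine:
  fixes T :: "'b::real_normed_vector \<Rightarrow> real"
  assumes "finite_measure M" and "subalgebra M N" and "is_cond_exp M N X Z"
    and T: "bounded_linear T" and "A \<in> sets N"
  shows "\<exists>v. has_bochner_integral M (\<lambda>\<omega>. indicator A \<omega> * (b + T (X \<omega>))) v \<and>
             has_bochner_integral M (\<lambda>\<omega>. indicator A \<omega> * (b + T (Z \<omega>))) v"
proof -
  interpret finite_measure M by fact
  have A: "A \<in> sets M"
    using assms(2,5) by (auto simp: subalgebra_def)
  obtain v where v: "has_strong_bochner_integral M (\<lambda>\<omega>. indicator A \<omega> *\<^sub>R X \<omega>) v"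
    "has_strong_bochner_integral M (\<lambda>\<omega>. indicator A \<omega> *\<^sub>R Z \<omega>) v"
    using assms(3,5) by (auto simp: is_cond_exp_def)
  have "integrable M (\<lambda>\<omega>. indicator A \<omega> * b)"
    using A by (intro integrable_mult_left) (auto simp: less_top[symmetric])
  then have b: "has_bochner_integral M (\<lambda>\<omega>. indicator A \<omega> * b) (\<integral>\<omega>. indicator A \<omega> * b \<partial>M)"
    by (rule has_bochner_integral_integrable)
  show ?thesis
    using has_bochner_integral_add[OF b has_strong_bochner_integral_bounded_linear[OF T v(1)]]
      has_bochner_integral_add[OF b has_strong_bochner_integral_bounded_linear[OF T v(2)]]
    by (auto simp: distrib_left linear_cmul[OF bounded_linear.linear[OF T]])
qed

section \<open>Separability of the ranges\<close>

text \<open>\<open>C\<close> need not lie in \<open>R\<close>. For each \<open>c\<close> in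
  \<open>C\<close> and each radius \<open>1/(n+1)\<close> whose ball around \<open>c\<close> meets
  \<open>R\<close>, one point of that intersection is chosen; these countably many points are dense
  in \<open>R\<close>.\<close>

lemma countable_dense_subset_exists:
  fixes R :: "'a::metric_space set"
  assumes "countable C" and "R \<subseteq> closure C"
  obtains Q where "countable Q" "Q \<subseteq> R" "R \<subseteq> closure Q"
proof
  define P where "P = {p \<in> C \<times> (UNIV::nat set). R \<inter> ball (fst p) (inverse (real (Suc (snd p)))) \<noteq> {}}"
  define g where "g p = (SOME x. x \<in> R \<inter> ball (fst p) (inverse (real (Suc (snd p)))))" for p
  have g: "g p \<in> R \<inter> ball (fst p) (inverse (real (Suc (snd p))))" if "p \<in> P" for p
    unfolding g_def by (rule someI_ex) (use that in \<open>auto simp: P_def\<close>)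
  show "countable (g ` P)"
    unfolding P_def by (rule countable_image, rule countable_subset[of _ "C \<times> UNIV"]) (use assms in auto)
  show "g ` P \<subseteq> R"
    using g by auto
  show "R \<subseteq> closure (g ` P)"
  proof
    fix x assume x: "x \<in> R"
    show "x \<in> closure (g ` P)"
      unfolding closure_approachable
    proof (intro allI impI)
      fix e :: real assume "0 < e"
      then obtain n where n: "inverse (real (Suc n)) < e / 2"
        using reals_Archimedean[of "e / 2"] by auto
      obtain c where c: "c \<in> C" "dist c x < inverse (real (Suc n))"
        using x assms(2) by (meson closure_approachable inverse_positive_iff_positive of_nat_0_less_iff
            subsetD zero_less_Suc)
      then have "(c, n) \<in> P"
        using x by (auto simp: P_def)
      moreover have "dist (g (c, n)) x < e"
        using g[OF \<open>(c, n) \<in> P\<close>] c n dist_triangle[of "g (c, n)" x c]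
        by (auto simp: dist_commute)
      ultimately show "\<exists>y\<in>g ` P. dist y x < e" by blast
    qed
  qed
qed

text \<open>The approximating simple functions together take only countably many values, and every
  value of \<open>f\<close> is a limit of such values.\<close>

lemma strongly_measurable_countable_closure:
  fixes f :: "'a \<Rightarrow> 'b::metric_space"
  assumes "strongly_measurable M f"
  obtains C where "countable C" "f ` space M \<subseteq> closure C"
proof -
  obtain u where u: "\<And>i::nat. simple_function M (u i)"
    "\<And>x. x \<in> space M \<Longrightarrow> (\<lambda>i. u i x) \<longlonglongrightarrow> f x"
    using assms by (auto simp: strongly_measurable_def)
  show ?thesis
  proof
    show "countable (\<Union>i. u i ` space M)"
      using u(1) by (intro countable_UN countableI_type countable_finite[OF simple_functionD(1)])
    show "f ` space M \<subseteq> closure (\<Union>i. u i ` space M)"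
    proof safe
      fix x assume "x \<in> space M"
      with u(2) show "f x \<in> closure (\<Union>i. u i ` space M)"
        unfolding closure_sequential by (intro exI[of _ "\<lambda>i. u i x"]) auto
    qed
  qed
qed

section \<open>Tangents of strictly convex functions\<close>

text \<open>The derivative is taken within \<Omega> and \<open>y\<close> may be a boundary point, so
  only steps in \<open>{0..1}\<close> along the segment towards \<open>x\<close> are used. The limit
  serves both the gradient inequality and the measurability of derivatives.\<close>

lemma directional_quotient_tendsto:
  fixes f :: "'w::real_normed_vector \<Rightarrow> real"
  assumes "convex \<Omega>" "x \<in> \<Omega>" "y \<in> \<Omega>"
    and f': "(f has_derivative f') (at y within \<Omega>)"
  shows "(\<lambda>k. (f (y + inverse (real (Suc k)) *\<^sub>R (x - y)) - f y) * real (Suc k)) \<longlonglongrightarrow> f' (x - y)"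
proof -
  have seg: "(\<lambda>t. y + t *\<^sub>R (x - y)) ` {0..1} \<subseteq> \<Omega>"
    using assms(1-3) by (auto simp: convex_alt algebra_simps)
  have "((\<lambda>t. f (y + t *\<^sub>R (x - y))) has_derivative (\<lambda>t. f' (t *\<^sub>R (x - y)))) (at 0 within {0..1})"
    by (rule has_derivative_in_compose[where f="\<lambda>t. y + t *\<^sub>R (x - y)"])
      (use has_derivative_subset[OF f' seg] in \<open>auto intro!: derivative_eq_intros\<close>)
  also have "(\<lambda>t. f' (t *\<^sub>R (x - y))) = (*) (f' (x - y))"
    by (simp add: fun_eq_iff linear_cmul[OF has_derivative_linear[OF f']])
  finally have "((\<lambda>t. f (y + t *\<^sub>R (x - y))) has_real_derivative f' (x - y)) (at 0 within {0..1})"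
    by (simp add: has_field_derivative_def)
  then have lim: "((\<lambda>t. (f (y + t *\<^sub>R (x - y)) - f y) / t) \<longlongrightarrow> f' (x - y)) (at 0 within {0..1})"
    by (simp add: has_field_derivative_iff)
  have "filterlim (\<lambda>k. inverse (real (Suc k))) (at 0 within {0..1}) sequentially"
    using LIMSEQ_inverse_real_of_nat
    by (auto simp: filterlim_at inverse_le_1_iff)
  from filterlim_compose[OF lim this] show ?thesis
    by (simp add: divide_inverse)
qed

text \<open>The limit of difference quotients yields only the weak inequality. Strictness comes from
  applying the weak inequality at the midpoint \<open>m\<close> and strict convexity to
  \<open>f m\<close>.\<close>

lemma strictly_convex_gradient_less:
  fixes f :: "'w::real_normed_vector \<Rightarrow> real"
  assumes "convex \<Omega>"
    and sc: "\<And>x y \<theta>. x \<in> \<Omega> \<Longrightarrow> y \<in> \<Omega> \<Longrightarrow> x \<noteq> y \<Longrightarrow> 0 < \<theta> \<Longrightarrow> \<theta> < 1 \<Longrightarrow>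
      f (\<theta> *\<^sub>R x + (1 - \<theta>) *\<^sub>R y) < \<theta> * f x + (1 - \<theta>) * f y"
    and xy: "x \<in> \<Omega>" "y \<in> \<Omega>" "x \<noteq> y"
    and f': "(f has_derivative f') (at y within \<Omega>)"
  shows "f' (x - y) < f x - f y"
proof -
  have le: "f' (z - y) \<le> f z - f y" if z: "z \<in> \<Omega>" "z \<noteq> y" for z
  proof (rule LIMSEQ_le_const2[OF directional_quotient_tendsto[OF assms(1) z(1) xy(2) f']])
    \<comment> \<open>The index \<open>k = 0\<close> would give the step 1, which \<open>sc\<close>
      excludes.\<close>
    have "(f (y + inverse (real (Suc k)) *\<^sub>R (z - y)) - f y) * real (Suc k) \<le> f z - f y" if "k \<ge> 1" for k
    proof -
      let ?t = "inverse (real (Suc k))"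
      have "f (?t *\<^sub>R z + (1 - ?t) *\<^sub>R y) < ?t * f z + (1 - ?t) * f y"
        using that by (intro sc z xy(2)) (auto simp: field_simps)
      also have "?t *\<^sub>R z + (1 - ?t) *\<^sub>R y = y + ?t *\<^sub>R (z - y)"
        by (simp add: algebra_simps)
      finally have "f (y + ?t *\<^sub>R (z - y)) - f y \<le> ?t * (f z - f y)"
        by (simp add: algebra_simps)
      then have "(f (y + ?t *\<^sub>R (z - y)) - f y) * real (Suc k) \<le> (?t * (f z - f y)) * real (Suc k)"
        by (rule mult_right_mono) simp
      also have "\<dots> = f z - f y"
        by (simp add: field_simps del: of_nat_Suc)
      finally show ?thesis .
    qed
    then show "\<exists>N. \<forall>k\<ge>N. (f (y + inverse (real (Suc k)) *\<^sub>R (z - y)) - f y) * real (Suc k) \<le> f z - f y"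
      by blast
  qed
  define m where "m = (1/2) *\<^sub>R x + (1 - 1/2) *\<^sub>R y"
  have m: "m \<in> \<Omega>"
    unfolding m_def by (rule convexD[OF assms(1) xy(1,2)]) auto
  have my: "m - y = (1/2) *\<^sub>R (x - y)"
    by (simp add: m_def algebra_simps flip: scaleR_add_left)
  then have "m \<noteq> y"
    using xy(3) by auto
  have "(1/2) * f' (x - y) = f' (m - y)"
    by (simp add: my linear_cmul[OF has_derivative_linear[OF f']])
  also have "\<dots> \<le> f m - f y"
    by (rule le[OF m \<open>m \<noteq> y\<close>])
  also have "f m < (1/2) * f x + (1 - 1/2) * f y"
    unfolding m_def by (rule sc[OF xy]) auto
  finally show ?thesis by simp
qed

section \<open>Positive functionals on proper cones\<close>

text \<open>Pointedness keeps 0 out of the interior, so a hyperplane separates it from the interior.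
  The sign extends to \<open>K\<close>, which is the closure of its interior, and becomes strict at
  interior points, since these can be moved a little in the direction \<open>- a\<close>.\<close>

lemma proper_cone_supporting_functional:
  fixes K :: "'a::euclidean_space set"
  assumes "proper_cone K"
  obtains a where "\<And>x. x \<in> K \<Longrightarrow> 0 \<le> inner a x" "\<And>x. x \<in> interior K \<Longrightarrow> 0 < inner a x"
proof -
  have K: "convex K" "closed K" "interior K \<noteq> {}"
    and pointed: "\<And>x. x \<in> K \<Longrightarrow> - x \<in> K \<Longrightarrow> x = 0"
    using assms by (auto simp: proper_cone_def)
  have "0 \<notin> interior K"
  proof
    assume "0 \<in> interior K"
    then obtain e where e: "e > 0" "cball 0 e \<subseteq> K"
      using mem_interior_cball by blast
    obtain b :: 'a where b: "b \<in> Basis"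
      using nonempty_Basis by blast
    have "e *\<^sub>R b \<in> K" "- (e *\<^sub>R b) \<in> K"
      using e b by (auto intro!: subsetD[OF e(2)])
    with pointed have "e *\<^sub>R b = 0" by blast
    with e b show False by auto
  qed
  from separating_hyperplane_set_0[OF convex_interior[OF K(1)] this]
  obtain a where a: "a \<noteq> 0" "\<And>x. x \<in> interior K \<Longrightarrow> 0 \<le> inner a x" by blast
  show ?thesis
  proof
    fix x assume "x \<in> K"
    then have "x \<in> closure (interior K)"
      using K by (simp add: convex_closure_interior)
    moreover have "closure (interior K) \<subseteq> {x. 0 \<le> inner a x}"
      using a by (intro closure_minimal closed_halfspace_ge) auto
    ultimately show "0 \<le> inner a x" by auto
  next
    fix x assume "x \<in> interior K"
    then obtain e where e: "e > 0" "cball x e \<subseteq> interior K"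
      using open_interior open_contains_cball by blast
    \<comment> \<open>The displacement has length \<open>e\<close>, so the point stays in the
      ball.\<close>
    have "x - (e / norm a) *\<^sub>R a \<in> interior K"
      using e a by (intro subsetD[OF e(2)]) (auto simp: dist_norm)
    from a(2)[OF this] have "(e / norm a) * (inner a a) \<le> inner a x"
      by (simp add: inner_diff_right)
    moreover have "0 < (e / norm a) * (inner a a)"
      using e a by simp
    ultimately show "0 < inner a x" by linarith
  qed
qed

section \<open>Conditional expectations inside random affine functions\<close>

text \<open>On \<open>A\<close> the random function is a limit of functions that are one
  deterministic affine functional on each of finitely many cells in \<open>N\<close>. On a cell the
  integrals for \<open>X\<close> and \<open>Z\<close> agree; dominated convergence carries the
  equality to the limit. Measurability is asked only of the values at the points of the countable
  set \<open>Q\<close>.\<close>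

lemma is_cond_exp_integral_random_affine:
  fixes b :: "'s \<Rightarrow> real" and T :: "'s \<Rightarrow> 'w::real_normed_vector \<Rightarrow> real"
    and X Z :: "'s \<Rightarrow> 'w"
  defines "L \<equiv> \<lambda>\<omega> x. b \<omega> + T \<omega> x"
  assumes M: "finite_measure M" and N: "subalgebra M N" and cond: "is_cond_exp M N X Z"
    and X: "integrable M (\<lambda>\<omega>. norm (X \<omega>))"
    and T: "\<And>\<omega>. \<omega> \<in> space M \<Longrightarrow> bounded_linear (T \<omega>)"
    and Q: "countable Q" "q0 \<in> Q" "X ` space M \<subseteq> closure Q" "Z ` space M \<subseteq> closure Q"
    and meas: "\<And>q. q \<in> Q \<Longrightarrow> (\<lambda>\<omega>. L \<omega> q) \<in> borel_measurable N"
    and A: "A \<in> sets N" and C: "C > 0"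
    and lip: "\<And>\<omega> p q. \<omega> \<in> A \<Longrightarrow> p \<in> Q \<Longrightarrow> q \<in> Q \<Longrightarrow> \<bar>L \<omega> p - L \<omega> q\<bar> \<le> C * norm (p - q)"
    and bound: "\<And>\<omega>. \<omega> \<in> A \<Longrightarrow> \<bar>L \<omega> q0\<bar> \<le> C"
    and Z: "\<And>\<omega>. \<omega> \<in> A \<Longrightarrow> norm (Z \<omega>) \<le> C"
  shows "integrable M (\<lambda>\<omega>. indicator A \<omega> * L \<omega> (Z \<omega>))"
    and "(\<integral>\<omega>. indicator A \<omega> * L \<omega> (X \<omega>) \<partial>M) = (\<integral>\<omega>. indicator A \<omega> * L \<omega> (Z \<omega>) \<partial>M)"
proof -
  interpret finite_measure M by fact
  have AM: "A \<subseteq> space M"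
    using A N sets.sets_into_space by (fastforce simp: subalgebra_def)
  define e where "e = from_nat_into Q"
  have e: "range e = Q"
    unfolding e_def using Q by (intro range_from_nat_into) auto
  then have eQ: "e i \<in> Q" for i by blast
  \<comment> \<open>Continuity of \<open>T \<omega>\<close> extends the bound from \<open>Q\<close>
    to its closure, which contains the values of \<open>X\<close> and \<open>Z\<close>.\<close>
  have lip': "\<bar>L \<omega> x - L \<omega> q\<bar> \<le> C * norm (x - q)"
    if "\<omega> \<in> A" "x \<in> closure Q" "q \<in> Q" for \<omega> x q
  proof -
    interpret bounded_linear "T \<omega>" using T that AM by blast
    have "closed {x. \<bar>L \<omega> x - L \<omega> q\<bar> \<le> C * norm (x - q)}"
      unfolding L_def by (intro closed_Collect_le continuous_intros continuous_on)
    then have "closure Q \<subseteq> {x. \<bar>L \<omega> x - L \<omega> q\<bar> \<le> C * norm (x - q)}"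
      using lip that by (intro closure_minimal) auto
    then show ?thesis using that by auto
  qed
  have bound': "\<bar>L \<omega> x\<bar> \<le> C + C * (norm x + norm q0)" if "\<omega> \<in> A" "x \<in> closure Q" for \<omega> x
  proof -
    have "\<bar>L \<omega> x\<bar> \<le> C + C * norm (x - q0)"
      using lip'[OF that Q(2)] bound[OF that(1)] by linarith
    also have "\<dots> \<le> C + C * (norm x + norm q0)"
      using C norm_triangle_ineq4[of x q0] by simp
    finally show ?thesis .
  qed
  \<comment> \<open>Two points of \<open>A\<close> have the same label when the values of \<open>L\<close> at the first \<open>k\<close> points of \<open>Q\<close>
    agree up to \<open>1/(k+1)\<close>; on each of the finitely many cells, \<open>L\<close> is replaced by one of its values,
    a deterministic functional.\<close>
  define c where "c k \<omega> = restrict (\<lambda>i. \<lfloor>real (Suc k) * L \<omega> (e i)\<rfloor>) {..<k}" for k \<omega>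
  define r where "r k d = (SOME \<omega>. \<omega> \<in> A \<and> c k \<omega> = d)" for k d
  define cell where "cell k d = {\<omega> \<in> A. c k \<omega> = d}" for k d
  have r: "r k d \<in> A" "c k (r k d) = d" if "d \<in> c k ` A" for k d
  proof -
    have "\<exists>\<omega>. \<omega> \<in> A \<and> c k \<omega> = d" using that by auto
    from someI_ex[OF this] show "r k d \<in> A" "c k (r k d) = d" by (auto simp: r_def)
  qed
  \<comment> \<open>On \<open>A\<close> the values of \<open>L\<close> at each \<open>e i\<close>
    are bounded, so each of the \<open>k\<close> floors takes finitely many values.\<close>
  have fin: "finite (c k ` A)" for k
  proof (rule finite_subset)
    define B where "B i = real (Suc k) * (C + C * (norm (e i) + norm q0))" for i
    show "finite (PiE {..<k} (\<lambda>i. {\<lfloor>- B i\<rfloor>..\<lfloor>B i\<rfloor>}))"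
      by (intro finite_PiE) auto
    have "\<bar>real (Suc k) * L \<omega> (e i)\<bar> \<le> B i" if "\<omega> \<in> A" for \<omega> i
      using bound'[OF that subsetD[OF closure_subset eQ], of i]
      unfolding B_def abs_mult by (intro mult_mono) auto
    then have "- B i \<le> real (Suc k) * L \<omega> (e i) \<and> real (Suc k) * L \<omega> (e i) \<le> B i"
      if "\<omega> \<in> A" for \<omega> i
      using that by (metis abs_le_iff minus_le_iff)
    then show "c k ` A \<subseteq> PiE {..<k} (\<lambda>i. {\<lfloor>- B i\<rfloor>..\<lfloor>B i\<rfloor>})"
      unfolding c_def image_subset_iff restrict_PiE_iff
      by (auto simp del: of_nat_Suc intro!: floor_mono)
  qed
  have cell_sets: "cell k d \<in> sets N" if d: "d \<in> c k ` A" for k d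
  proof -
    obtain \<omega>0 where d: "d = c k \<omega>0" using d by blast
    have "cell k d = {\<omega> \<in> space N. \<omega> \<in> A \<and>
        (\<forall>i\<in>{..<k}. \<lfloor>real (Suc k) * L \<omega> (e i)\<rfloor> = \<lfloor>real (Suc k) * L \<omega>0 (e i)\<rfloor>)}"
      using sets.sets_into_space[OF A] unfolding cell_def d c_def restrict_def fun_eq_iff by auto
    also have "\<dots> \<in> sets N"
    proof -
      have [measurable]: "(\<lambda>\<omega>. L \<omega> (e i)) \<in> borel_measurable N" for i by (rule meas[OF eQ])
      show ?thesis using A by measurable
    qed
    finally show ?thesis .
  qed
  \<comment> \<open>The cells partition \<open>A\<close>, so at each of its points exactly one
    summand survives.\<close>
  have split: "(\<Sum>d\<in>c k ` A. indicator (cell k d) \<omega> * L (r k d) x) =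
      indicator A \<omega> * L (r k (c k \<omega>)) x" for k \<omega> x
  proof (cases "\<omega> \<in> A")
    case True
    then have "(\<Sum>d\<in>c k ` A. indicator (cell k d) \<omega> * L (r k d) x) =
        (\<Sum>d\<in>c k ` A. if d = c k \<omega> then L (r k d) x else 0)"
      by (intro sum.cong) (auto simp: cell_def)
    with True fin show ?thesis by simp
  qed (simp add: cell_def)
  have step: "\<exists>v. has_bochner_integral M (\<lambda>\<omega>. indicator A \<omega> * L (r k (c k \<omega>)) (X \<omega>)) v \<and>
      has_bochner_integral M (\<lambda>\<omega>. indicator A \<omega> * L (r k (c k \<omega>)) (Z \<omega>)) v" for k
  proof -
    have "\<forall>d\<in>c k ` A. \<exists>v.
        has_bochner_integral M (\<lambda>\<omega>. indicator (cell k d) \<omega> * L (r k d) (X \<omega>)) v \<and>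
        has_bochner_integral M (\<lambda>\<omega>. indicator (cell k d) \<omega> * L (r k d) (Z \<omega>)) v"
      unfolding L_def using r AM
      by (intro ballI is_cond_exp_has_bochner_integral_affine[OF M N cond T cell_sets]) blast+
    then obtain v where "\<And>d. d \<in> c k ` A \<Longrightarrow>
        has_bochner_integral M (\<lambda>\<omega>. indicator (cell k d) \<omega> * L (r k d) (X \<omega>)) (v d) \<and>
        has_bochner_integral M (\<lambda>\<omega>. indicator (cell k d) \<omega> * L (r k d) (Z \<omega>)) (v d)"
      by metis
    then have "has_bochner_integral M
          (\<lambda>\<omega>. \<Sum>d\<in>c k ` A. indicator (cell k d) \<omega> * L (r k d) (X \<omega>)) (sum v (c k ` A))"
      "has_bochner_integral M
          (\<lambda>\<omega>. \<Sum>d\<in>c k ` A. indicator (cell k d) \<omega> * L (r k d) (Z \<omega>)) (sum v (c k ` A))"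
      by (auto intro!: has_bochner_integral_sum)
    then show ?thesis unfolding split by blast
  qed
  have lim: "(\<lambda>k. indicator A \<omega> * L (r k (c k \<omega>)) x) \<longlonglongrightarrow> indicator A \<omega> * L \<omega> x"
    if x: "x \<in> closure Q" for \<omega> x
  proof (cases "\<omega> \<in> A")
    case True
    have "(\<lambda>k. L (r k (c k \<omega>)) x) \<longlonglongrightarrow> L \<omega> x"
    proof (rule metric_LIMSEQ_I)
      fix \<epsilon> :: real assume "0 < \<epsilon>"
      \<comment> \<open>Two Lipschitz errors below \<epsilon>/4, from passing between
        \<open>x\<close> and \<open>q\<close> at both sample points, and one label error below
        \<epsilon>/2 add up to less than \<epsilon>.\<close>
      then have "0 < \<epsilon> / (4 * C)" using C by simp
      then obtain q where q: "q \<in> Q" "dist q x < \<epsilon> / (4 * C)"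
        using x unfolding closure_approachable by blast
      then obtain i where i: "q = e i" using e by auto
      obtain n where n: "inverse (real (Suc n)) < \<epsilon> / 2"
        using reals_Archimedean[of "\<epsilon> / 2"] \<open>0 < \<epsilon>\<close> by auto
      have close: "C * norm (x - q) < \<epsilon> / 4"
        using q(2) C by (simp add: field_simps dist_norm norm_minus_commute)
      \<comment> \<open>\<open>k > i\<close> ensures that the label records the value at
        \<open>q = e i\<close>; \<open>k \<ge> n\<close> makes its resolution finer than
        \<epsilon>/2.\<close>
      have "dist (L (r k (c k \<omega>)) x) (L \<omega> x) < \<epsilon>" if k: "k \<ge> max n (Suc i)" for k
      proof -
        let ?\<rho> = "r k (c k \<omega>)"
        have \<rho>: "?\<rho> \<in> A" "c k ?\<rho> = c k \<omega>" using r[of "c k \<omega>" k] True by auto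
        have "c k ?\<rho> i = c k \<omega> i" using \<rho>(2) by simp
        then have "\<lfloor>real (Suc k) * L ?\<rho> q\<rfloor> = \<lfloor>real (Suc k) * L \<omega> q\<rfloor>"
          using k by (simp add: c_def i del: of_nat_Suc)
        then have "\<bar>real (Suc k) * L ?\<rho> q - real (Suc k) * L \<omega> q\<bar> < 1"
          by linarith
        then have "real (Suc k) * \<bar>L ?\<rho> q - L \<omega> q\<bar> < 1"
          by (simp add: abs_mult del: of_nat_Suc flip: right_diff_distrib)
        then have "\<bar>L ?\<rho> q - L \<omega> q\<bar> < inverse (real (Suc k))"
          by (simp add: field_simps)
        also have "\<dots> \<le> inverse (real (Suc n))"
          using k by (intro le_imp_inverse_le) auto
        finally have "\<bar>L ?\<rho> q - L \<omega> q\<bar> < \<epsilon> / 2" using n by linarith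
        with lip'[OF \<rho>(1) x q(1)] lip'[OF True x q(1)] close
        show ?thesis unfolding dist_real_def by linarith
      qed
      then show "\<exists>n0. \<forall>k\<ge>n0. dist (L (r k (c k \<omega>)) x) (L \<omega> x) < \<epsilon>" by blast
    qed
    then show ?thesis by (intro tendsto_intros)
  qed simp
  have step_bound: "\<bar>indicator A \<omega> * L (r k (c k \<omega>)) x\<bar> \<le> C + C * (norm x + norm q0)"
    if "x \<in> closure Q" for k \<omega> x
    using bound'[OF r(1) that, of "c k \<omega>" k] C by (auto simp: indicator_def)
  have limX: "(\<lambda>k. indicator A \<omega> * L (r k (c k \<omega>)) (X \<omega>)) \<longlonglongrightarrow> indicator A \<omega> * L \<omega> (X \<omega>)"
    and limZ: "(\<lambda>k. indicator A \<omega> * L (r k (c k \<omega>)) (Z \<omega>)) \<longlonglongrightarrow> indicator A \<omega> * L \<omega> (Z \<omega>)"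
    if "\<omega> \<in> space M" for \<omega>
    using lim Q(3,4) that by blast+
  have mX: "(\<lambda>\<omega>. indicator A \<omega> * L (r k (c k \<omega>)) (X \<omega>)) \<in> borel_measurable M"
    and mZ: "(\<lambda>\<omega>. indicator A \<omega> * L (r k (c k \<omega>)) (Z \<omega>)) \<in> borel_measurable M" for k
    using step[of k] by (auto dest: borel_measurable_has_bochner_integral)
  \<comment> \<open>The majorant for \<open>X\<close> is integrable because
    \<open>norm (X \<omega>)\<close> is; the one for \<open>Z\<close> is constant because
    \<open>Z\<close> is bounded by \<open>C\<close> on \<open>A\<close>.\<close>
  have bX: "AE \<omega> in M. norm (indicator A \<omega> * L (r k (c k \<omega>)) (X \<omega>))
      \<le> C + C * (norm (X \<omega>) + norm q0)" for k
    using step_bound Q(3) by (intro AE_I2) auto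
  have bZ: "AE \<omega> in M. norm (indicator A \<omega> * L (r k (c k \<omega>)) (Z \<omega>))
      \<le> C + C * (C + norm q0)" for k
  proof (intro AE_I2)
    fix \<omega> assume "\<omega> \<in> space M"
    show "norm (indicator A \<omega> * L (r k (c k \<omega>)) (Z \<omega>)) \<le> C + C * (C + norm q0)"
    proof (cases "\<omega> \<in> A")
      case True
      have "C + C * (norm (Z \<omega>) + norm q0) \<le> C + C * (C + norm q0)"
        using Z[OF True] C by simp
      then show ?thesis
        using step_bound[of "Z \<omega>" \<omega> k] Q(4) \<open>\<omega> \<in> space M\<close> by fastforce
    qed (use C in simp)
  qed
  have aeX: "AE \<omega> in M. (\<lambda>k. indicator A \<omega> * L (r k (c k \<omega>)) (X \<omega>))
      \<longlonglongrightarrow> indicator A \<omega> * L \<omega> (X \<omega>)"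
    and aeZ: "AE \<omega> in M. (\<lambda>k. indicator A \<omega> * L (r k (c k \<omega>)) (Z \<omega>))
      \<longlonglongrightarrow> indicator A \<omega> * L \<omega> (Z \<omega>)"
    using limX limZ by (auto intro: AE_I2)
  have wX: "integrable M (\<lambda>\<omega>. C + C * (norm (X \<omega>) + norm q0))"
    using X by simp
  have wZ: "integrable M (\<lambda>\<omega>. C + C * (C + norm q0))" by simp
  have lmX: "(\<lambda>\<omega>. indicator A \<omega> * L \<omega> (X \<omega>)) \<in> borel_measurable M"
    by (rule borel_measurable_LIMSEQ_metric[OF mX limX])
  have lmZ: "(\<lambda>\<omega>. indicator A \<omega> * L \<omega> (Z \<omega>)) \<in> borel_measurable M"
    by (rule borel_measurable_LIMSEQ_metric[OF mZ limZ])
  show "integrable M (\<lambda>\<omega>. indicator A \<omega> * L \<omega> (Z \<omega>))"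
    by (rule integrable_dominated_convergence[OF lmZ mZ wZ aeZ bZ])
  have "(\<lambda>k. \<integral>\<omega>. indicator A \<omega> * L (r k (c k \<omega>)) (X \<omega>) \<partial>M)
      \<longlonglongrightarrow> (\<integral>\<omega>. indicator A \<omega> * L \<omega> (X \<omega>) \<partial>M)"
    by (rule integral_dominated_convergence[OF lmX mX wX aeX bX])
  moreover have "(\<lambda>k. \<integral>\<omega>. indicator A \<omega> * L (r k (c k \<omega>)) (Z \<omega>) \<partial>M)
      \<longlonglongrightarrow> (\<integral>\<omega>. indicator A \<omega> * L \<omega> (Z \<omega>) \<partial>M)"
    by (rule integral_dominated_convergence[OF lmZ mZ wZ aeZ bZ])
  moreover have "(\<integral>\<omega>. indicator A \<omega> * L (r k (c k \<omega>)) (X \<omega>) \<partial>M) =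
      (\<integral>\<omega>. indicator A \<omega> * L (r k (c k \<omega>)) (Z \<omega>) \<partial>M)" for k
    using step[of k] by (auto simp: has_bochner_integral_integral_eq)
  ultimately show "(\<integral>\<omega>. indicator A \<omega> * L \<omega> (X \<omega>) \<partial>M) = (\<integral>\<omega>. indicator A \<omega> * L \<omega> (Z \<omega>) \<partial>M)"
    using LIMSEQ_unique by simp
qed

text \<open>Since \<open>L \<omega> (Z \<omega>)\<close> is known to be integrable only on the sets
  \<open>A n\<close>, the exchange of \<open>X\<close> and \<open>Z\<close> takes place there. The
  resulting nonnegative integrals increase to a limit that is at most 0, hence all vanish.\<close>

lemma is_cond_exp_random_affine_AE_eq_0:
  fixes b :: "'s \<Rightarrow> real" and T :: "'s \<Rightarrow> 'w::real_normed_vector \<Rightarrow> real"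
    and X Z :: "'s \<Rightarrow> 'w"
  defines "L \<equiv> \<lambda>\<omega> x. b \<omega> + T \<omega> x"
  assumes M: "finite_measure M" and N: "subalgebra M N" and cond: "is_cond_exp M N X Z"
    and X: "integrable M (\<lambda>\<omega>. norm (X \<omega>))"
    and T: "\<And>\<omega>. \<omega> \<in> space M \<Longrightarrow> bounded_linear (T \<omega>)"
    and Q: "countable Q" "X ` space M \<subseteq> closure Q" "Z ` space M \<subseteq> closure Q"
    and meas: "\<And>q. q \<in> Q \<Longrightarrow> (\<lambda>\<omega>. L \<omega> q) \<in> borel_measurable N"
    and LX: "integrable M (\<lambda>\<omega>. L \<omega> (X \<omega>))" "(\<integral>\<omega>. L \<omega> (X \<omega>) \<partial>M) \<le> 0"
    and LZ: "\<And>\<omega>. \<omega> \<in> space M \<Longrightarrow> 0 \<le> L \<omega> (Z \<omega>)"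
  shows "AE \<omega> in M. L \<omega> (Z \<omega>) = 0"
proof (cases "Q = {}")
  case True
  then have "space M = {}" using Q by auto
  then show ?thesis by (intro AE_I2) auto
next
  case False
  then obtain q0 where q0: "q0 \<in> Q" by blast
  interpret finite_measure M by fact
  have sp: "space N = space M" using N by (simp add: subalgebra_def)
  \<comment> \<open>Testing the Lipschitz bound on the countable set \<open>Q \<times> Q\<close>
    makes \<open>A n\<close> measurable; \<open>Suc n\<close> keeps the constant positive.\<close>
  define A where "A n = {\<omega> \<in> space N.
      (\<forall>p\<in>Q \<times> Q. \<bar>L \<omega> (fst p) - L \<omega> (snd p)\<bar> \<le> real (Suc n) * norm (fst p - snd p)) \<and>
      \<bar>L \<omega> q0\<bar> \<le> real (Suc n) \<and> norm (Z \<omega>) \<le> real (Suc n)}" for n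
  have A: "A n \<in> sets N" for n
  proof -
    have "Z \<in> borel_measurable N"
      using cond by (simp add: is_cond_exp_def strongly_measurable_imp_borel_measurable)
    then have [measurable]: "(\<lambda>\<omega>. norm (Z \<omega>)) \<in> borel_measurable N"
      by (rule measurable_compose) (intro borel_measurable_continuous_onI continuous_intros)
    have [measurable]: "{\<omega> \<in> space N. \<forall>p\<in>Q \<times> Q.
        \<bar>L \<omega> (fst p) - L \<omega> (snd p)\<bar> \<le> real (Suc n) * norm (fst p - snd p)} \<in> sets N"
    proof (rule sets.sets_Collect_countable_All')
      fix p assume "p \<in> Q \<times> Q"
      then have [measurable]: "(\<lambda>\<omega>. L \<omega> (fst p)) \<in> borel_measurable N"
        "(\<lambda>\<omega>. L \<omega> (snd p)) \<in> borel_measurable N"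
        using meas by auto
      show "{\<omega> \<in> space N. \<bar>L \<omega> (fst p) - L \<omega> (snd p)\<bar> \<le> real (Suc n) * norm (fst p - snd p)}
          \<in> sets N"
        by measurable
    qed (use Q in auto)
    have [measurable]: "(\<lambda>\<omega>. L \<omega> q0) \<in> borel_measurable N" by (rule meas[OF q0])
    show ?thesis unfolding A_def by measurable
  qed
  then have AM: "A n \<in> sets M" for n
    using N by (auto simp: subalgebra_def)
  have mono: "A n \<subseteq> A m" if "n \<le> m" for n m
  proof -
    have *: "real (Suc n) \<le> real (Suc m)" using that by simp
    show ?thesis
      unfolding A_def by (auto simp del: of_nat_Suc intro: order_trans[OF _ *]
          order_trans[OF _ mult_right_mono[OF * norm_ge_zero]])
  qed
  \<comment> \<open>The operator bound of \<open>T \<omega>\<close> depends on \<omega> but is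
    finite, so every point enters some \<open>A n\<close>.\<close>
  have ex: "\<exists>n. \<omega> \<in> A n" if \<omega>: "\<omega> \<in> space M" for \<omega>
  proof -
    interpret bounded_linear "T \<omega>" by (rule T[OF \<omega>])
    obtain C where C: "\<And>x. norm (T \<omega> x) \<le> norm x * C" using bounded by blast
    obtain n where n: "max C (max \<bar>L \<omega> q0\<bar> (norm (Z \<omega>))) \<le> real n"
      using real_arch_simple by blast
    have "\<bar>L \<omega> x - L \<omega> y\<bar> \<le> real (Suc n) * norm (x - y)" for x y
    proof -
      have "\<bar>L \<omega> x - L \<omega> y\<bar> \<le> C * norm (x - y)"
        using C[of "x - y"] by (simp add: L_def diff mult.commute)
      also have "\<dots> \<le> real (Suc n) * norm (x - y)"
        using n by (intro mult_right_mono) auto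
      finally show ?thesis .
    qed
    then have "\<omega> \<in> A n" using \<omega> n by (auto simp: A_def sp)
    then show ?thesis ..
  qed
  have key: "integrable M (\<lambda>\<omega>. indicator (A n) \<omega> * L \<omega> (Z \<omega>))"
    "(\<integral>\<omega>. indicator (A n) \<omega> * L \<omega> (X \<omega>) \<partial>M) = (\<integral>\<omega>. indicator (A n) \<omega> * L \<omega> (Z \<omega>) \<partial>M)" for n
    unfolding L_def
    by (rule is_cond_exp_integral_random_affine[OF M N cond X T Q(1) q0 Q(2,3), where C="real (Suc n)"];
        use meas A in \<open>auto simp: A_def L_def\<close>)+
  have conv: "(\<lambda>n. \<integral>\<omega>. indicator (A n) \<omega> * L \<omega> (X \<omega>) \<partial>M) \<longlonglongrightarrow> (\<integral>\<omega>. L \<omega> (X \<omega>) \<partial>M)"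
  proof (rule integral_dominated_convergence)
    show "AE \<omega> in M. (\<lambda>n. indicator (A n) \<omega> * L \<omega> (X \<omega>)) \<longlonglongrightarrow> L \<omega> (X \<omega>)"
    proof (intro AE_I2)
      fix \<omega> assume "\<omega> \<in> space M"
      then obtain m where m: "\<omega> \<in> A m" using ex by blast
      have "\<forall>\<^sub>F n in sequentially. indicator (A n) \<omega> * L \<omega> (X \<omega>) = L \<omega> (X \<omega>)"
        using eventually_ge_at_top[of m]
        by eventually_elim (use mono m in \<open>auto simp: indicator_def\<close>)
      then show "(\<lambda>n. indicator (A n) \<omega> * L \<omega> (X \<omega>)) \<longlonglongrightarrow> L \<omega> (X \<omega>)"
        by (rule tendsto_eventually)
    qed
    show "integrable M (\<lambda>\<omega>. \<bar>L \<omega> (X \<omega>)\<bar>)" using LX by simp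
    show "(\<lambda>\<omega>. L \<omega> (X \<omega>)) \<in> borel_measurable M" using LX by simp
    show "(\<lambda>\<omega>. indicator (A n) \<omega> * L \<omega> (X \<omega>)) \<in> borel_measurable M" for n
      using LX AM by (intro borel_measurable_times) auto
    show "AE \<omega> in M. norm (indicator (A n) \<omega> * L \<omega> (X \<omega>)) \<le> \<bar>L \<omega> (X \<omega>)\<bar>" for n
      by (auto simp: indicator_def)
  qed
  have "incseq (\<lambda>n. \<integral>\<omega>. indicator (A n) \<omega> * L \<omega> (Z \<omega>) \<partial>M)"
  proof (rule incseq_SucI, rule integral_mono[OF key(1) key(1)])
    show "indicator (A n) \<omega> * L \<omega> (Z \<omega>) \<le> indicator (A (Suc n)) \<omega> * L \<omega> (Z \<omega>)"
      if "\<omega> \<in> space M" for n \<omega>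
      using mono[of n "Suc n"] LZ[OF that] by (auto simp: indicator_def)
  qed
  \<comment> \<open>Through \<open>key(2)\<close>, \<open>conv\<close> also gives the limit of the
    increasing integrals for \<open>Z\<close>, which bounds each of them.\<close>
  then have le: "(\<integral>\<omega>. indicator (A n) \<omega> * L \<omega> (Z \<omega>) \<partial>M) \<le> 0" for n
    using incseq_le[of "\<lambda>n. \<integral>\<omega>. indicator (A n) \<omega> * L \<omega> (Z \<omega>) \<partial>M", OF _ conv[unfolded key(2)], of n]
      LX(2) by linarith
  have "AE \<omega> in M. indicator (A n) \<omega> * L \<omega> (Z \<omega>) = 0" for n
  proof -
    have nn: "AE \<omega> in M. 0 \<le> indicator (A n) \<omega> * L \<omega> (Z \<omega>)"
      using LZ by (intro AE_I2) simp
    have "(\<integral>\<omega>. indicator (A n) \<omega> * L \<omega> (Z \<omega>) \<partial>M) = 0"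
      using le[of n] integral_nonneg_AE[OF nn] by linarith
    then show ?thesis
      using integral_nonneg_eq_0_iff_AE[OF key(1) nn] by simp
  qed
  then have "AE \<omega> in M. \<forall>n. indicator (A n) \<omega> * L \<omega> (Z \<omega>) = 0"
    unfolding AE_all_countable by blast
  then show ?thesis
  proof (rule AE_mp, intro AE_I2 impI)
    fix \<omega> assume "\<omega> \<in> space M" and 0: "\<forall>n. indicator (A n) \<omega> * L \<omega> (Z \<omega>) = 0"
    then obtain n where "\<omega> \<in> A n" using ex by blast
    with 0[rule_format, of n] show "L \<omega> (Z \<omega>) = 0" by simp
  qed
qed

section \<open>Tangents at random points and the reduction to real values\<close>

text \<open>The derivative in the direction \<open>x - y\<close> is a pointwise limit of difference
  quotients, each continuous in \<open>y\<close> because \<open>f\<close> is. Taking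
  \<open>x\<close> in \<Omega> keeps the points of evaluation in \<Omega>.\<close>

lemma tangent_measurable:
  fixes f :: "'w::real_normed_vector \<Rightarrow> real"
  assumes "convex \<Omega>" and f': "\<And>y. y \<in> \<Omega> \<Longrightarrow> (f has_derivative f' y) (at y within \<Omega>)"
    and "x \<in> \<Omega>"
  shows "(\<lambda>y. f y + f' y (x - y)) \<in> borel_measurable (restrict_space borel \<Omega>)"
proof -
  have cont: "continuous_on \<Omega> f"
    using f' by (rule has_derivative_continuous_on)
  have "(\<lambda>y. f' y (x - y)) \<in> borel_measurable (restrict_space borel \<Omega>)"
  proof (rule borel_measurable_LIMSEQ_metric)
    fix k
    let ?t = "inverse (real (Suc k))"
    have "(\<lambda>y. y + ?t *\<^sub>R (x - y)) ` \<Omega> \<subseteq> \<Omega>"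
    proof safe
      fix y assume "y \<in> \<Omega>"
      then have "?t *\<^sub>R x + (1 - ?t) *\<^sub>R y \<in> \<Omega>"
        using assms(1,3) by (intro convexD) (auto simp: field_simps)
      then show "y + ?t *\<^sub>R (x - y) \<in> \<Omega>" by (simp add: algebra_simps)
    qed
    then have "continuous_on \<Omega> (\<lambda>y. f (y + ?t *\<^sub>R (x - y)))"
      by (intro continuous_on_compose2[OF cont] continuous_intros)
    then show "(\<lambda>y. (f (y + ?t *\<^sub>R (x - y)) - f y) * real (Suc k))
        \<in> borel_measurable (restrict_space borel \<Omega>)"
      by (intro borel_measurable_continuous_on_restrict continuous_intros cont)
  next
    fix y assume "y \<in> space (restrict_space borel \<Omega>)"
    then have "y \<in> \<Omega>" by (simp add: space_restrict_space)
    then show "(\<lambda>k. (f (y + inverse (real (Suc k)) *\<^sub>R (x - y)) - f y) * real (Suc k))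
        \<longlonglongrightarrow> f' y (x - y)"
      using assms by (intro directional_quotient_tendsto)
  qed
  with borel_measurable_continuous_on_restrict[OF cont] show ?thesis
    by (rule borel_measurable_add)
qed

theorem theorem4:
  fixes M S1 :: "'s measure"
    and K :: "(real ^ 'n ^ 'm) set"
    and \<Omega> :: "'w::banach set"
    and F :: "'w \<Rightarrow> real ^ 'n ^ 'm"
    and DF :: "'w \<Rightarrow> 'w \<Rightarrow> real ^ 'n ^ 'm"
    and X Z :: "'s \<Rightarrow> 'w"
  assumes "prob_space M"
    and "subalgebra M S1"
    and "proper_cone K"
    and "convex \<Omega>"
    and "\<forall>x\<in>\<Omega>. (F has_derivative DF x) (at x within \<Omega>)"
    and "strictly_cone_convex_on \<Omega> K F"
    and "strongly_measurable M X"
    and "\<forall>\<omega>\<in>space M. X \<omega> \<in> \<Omega>"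
    and "integrable M (\<lambda>\<omega>. norm (X \<omega>))"
    and "integrable M (\<lambda>\<omega>. norm (F (X \<omega>)))"
    and "is_cond_exp M S1 X Z"
    and "\<forall>\<omega>\<in>space M. Z \<omega> \<in> \<Omega>"
    and "integrable M (\<lambda>\<omega>. bregman_div F DF (X \<omega>) (Z \<omega>))"
  shows "\<forall>Y'. strongly_measurable S1 Y' \<and> (\<forall>\<omega>\<in>space M. Y' \<omega> \<in> \<Omega>) \<and>
           integrable M (\<lambda>\<omega>. bregman_div F DF (X \<omega>) (Y' \<omega>)) \<and>
           cone_le K (\<integral>\<omega>. bregman_div F DF (X \<omega>) (Y' \<omega>) \<partial>M)
                     (\<integral>\<omega>. bregman_div F DF (X \<omega>) (Z \<omega>) \<partial>M)
           \<longrightarrow> (AE \<omega> in M. Y' \<omega> = Z \<omega>)"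
proof (intro allI impI, elim conjE)
  fix Y
  assume Y: "strongly_measurable S1 Y" "\<forall>\<omega>\<in>space M. Y \<omega> \<in> \<Omega>"
    and intY: "integrable M (\<lambda>\<omega>. bregman_div F DF (X \<omega>) (Y \<omega>))"
    and le: "cone_le K (\<integral>\<omega>. bregman_div F DF (X \<omega>) (Y \<omega>) \<partial>M)
                       (\<integral>\<omega>. bregman_div F DF (X \<omega>) (Z \<omega>) \<partial>M)"
  note intZ = assms(13)
  interpret prob_space M by fact
  have sp: "space S1 = space M" using assms(2) by (simp add: subalgebra_def)
  obtain a where a: "\<And>x. x \<in> K \<Longrightarrow> 0 \<le> inner a x" "\<And>x. x \<in> interior K \<Longrightarrow> 0 < inner a x"
    using proper_cone_supporting_functional[OF assms(3)] by blast
  define f where "f x = inner a (F x)" for x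
  define g where "g y h = inner a (DF y h)" for y h
  have g: "(f has_derivative g y) (at y within \<Omega>)" if "y \<in> \<Omega>" for y
    unfolding f_def g_def by (rule has_derivative_inner_right) (use assms(5) that in blast)
  have sc: "f (\<theta> *\<^sub>R x + (1 - \<theta>) *\<^sub>R y) < \<theta> * f x + (1 - \<theta>) * f y"
    if "x \<in> \<Omega>" "y \<in> \<Omega>" "x \<noteq> y" "0 < \<theta>" "\<theta> < 1" for x y \<theta>
  proof -
    have "\<theta> *\<^sub>R F x + (1 - \<theta>) *\<^sub>R F y - F (\<theta> *\<^sub>R x + (1 - \<theta>) *\<^sub>R y) \<in> interior K"
      using assms(6) that by (auto simp: strictly_cone_convex_on_def cone_less_def)
    from a(2)[OF this] show ?thesis
      by (simp add: f_def inner_diff_right inner_add_right)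
  qed
  have less: "g y (x - y) < f x - f y" if "x \<in> \<Omega>" "y \<in> \<Omega>" "x \<noteq> y" for x y
    by (rule strictly_convex_gradient_less[OF assms(4) sc that g]) (use that in auto)
  \<comment> \<open>\<open>b\<close> and \<open>T\<close> are the constant and the linear part of
    the tangent of \<open>f\<close> at \<open>Z \<omega>\<close> minus the tangent at
    \<open>Y \<omega>\<close>.\<close>
  define b where "b \<omega> = (f (Z \<omega>) - g (Z \<omega>) (Z \<omega>)) - (f (Y \<omega>) - g (Y \<omega>) (Y \<omega>))" for \<omega>
  define T where "T \<omega> x = g (Z \<omega>) x - g (Y \<omega>) x" for \<omega> x
  have L: "b \<omega> + T \<omega> x = (f (Z \<omega>) + g (Z \<omega>) (x - Z \<omega>)) - (f (Y \<omega>) + g (Y \<omega>) (x - Y \<omega>))"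
    if "\<omega> \<in> space M" for \<omega> x
    using that assms(12) Y(2)
    by (simp add: b_def T_def linear_diff[OF has_derivative_linear[OF g]])
  \<comment> \<open>The terms \<open>f (X \<omega>)\<close> of the two divergences cancel, which
    leaves an expression affine in \<open>X \<omega>\<close>.\<close>
  have LX: "b \<omega> + T \<omega> (X \<omega>) =
      inner a (bregman_div F DF (X \<omega>) (Y \<omega>)) - inner a (bregman_div F DF (X \<omega>) (Z \<omega>))"
    if "\<omega> \<in> space M" for \<omega>
    unfolding L[OF that] by (simp add: bregman_div_def f_def g_def inner_diff_right)
  have LZ: "b \<omega> + T \<omega> (Z \<omega>) = f (Z \<omega>) - f (Y \<omega>) - g (Y \<omega>) (Z \<omega> - Y \<omega>)"
    if "\<omega> \<in> space M" for \<omega>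
    using that assms(12) unfolding L[OF that]
    by (simp add: linear_0[OF has_derivative_linear[OF g]])
  have SZ: "strongly_measurable S1 Z" using assms(11) by (simp add: is_cond_exp_def)
  obtain C1 where C1: "countable C1" "X ` space M \<subseteq> closure C1"
    using strongly_measurable_countable_closure[OF assms(7)] by blast
  obtain C2 where C2: "countable C2" "Z ` space M \<subseteq> closure C2"
    using strongly_measurable_countable_closure[OF SZ] sp by metis
  \<comment> \<open>\<open>C1\<close> and \<open>C2\<close> may leave \<Omega>. The dense set is
    chosen inside the ranges because \<open>tangent\<close> evaluates at points of \<Omega>.\<close>
  obtain Q where Q: "countable Q" "Q \<subseteq> X ` space M \<union> Z ` space M"
    "X ` space M \<union> Z ` space M \<subseteq> closure Q"
    by (rule countable_dense_subset_exists[of "C1 \<union> C2" "X ` space M \<union> Z ` space M"])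
      (use C1 C2 in auto)
  have tangent: "(\<lambda>\<omega>. f (U \<omega>) + g (U \<omega>) (q - U \<omega>)) \<in> borel_measurable S1"
    if "q \<in> \<Omega>" "strongly_measurable S1 U" "\<forall>\<omega>\<in>space M. U \<omega> \<in> \<Omega>" for q U
  proof -
    have "U \<in> measurable S1 (restrict_space borel \<Omega>)"
      using that(2,3) sp
      by (intro measurable_restrict_space2 strongly_measurable_imp_borel_measurable) auto
    from measurable_compose[OF this tangent_measurable[OF assms(4) g that(1)]]
    show ?thesis .
  qed
  have "AE \<omega> in M. b \<omega> + T \<omega> (Z \<omega>) = 0"
  proof (rule is_cond_exp_random_affine_AE_eq_0[OF finite_measure_axioms assms(2,11,9) _ Q(1)])
    show "bounded_linear (T \<omega>)" if "\<omega> \<in> space M" for \<omega>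
      unfolding T_def using that assms(12) Y(2)
      by (intro bounded_linear_sub has_derivative_bounded_linear[OF g]) auto
    show "X ` space M \<subseteq> closure Q" "Z ` space M \<subseteq> closure Q" using Q by auto
    show "(\<lambda>\<omega>. b \<omega> + T \<omega> q) \<in> borel_measurable S1" if "q \<in> Q" for q
    proof -
      have q: "q \<in> \<Omega>" using that Q(2) assms(8,12) by blast
      have "(\<lambda>\<omega>. (f (Z \<omega>) + g (Z \<omega>) (q - Z \<omega>)) - (f (Y \<omega>) + g (Y \<omega>) (q - Y \<omega>)))
          \<in> borel_measurable S1"
        by (intro borel_measurable_diff tangent q SZ Y assms(12))
      then show ?thesis
        by (subst measurable_cong[OF L]) (use sp in auto)
    qed
    show "integrable M (\<lambda>\<omega>. b \<omega> + T \<omega> (X \<omega>))"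
      by (subst Bochner_Integration.integrable_cong[OF refl LX])
        (use intY intZ in auto)
    have "(\<integral>\<omega>. b \<omega> + T \<omega> (X \<omega>) \<partial>M) = inner a (\<integral>\<omega>. bregman_div F DF (X \<omega>) (Y \<omega>) \<partial>M)
        - inner a (\<integral>\<omega>. bregman_div F DF (X \<omega>) (Z \<omega>) \<partial>M)"
      by (subst Bochner_Integration.integral_cong[OF refl LX])
        (use intY intZ in \<open>auto simp: integral_inner_right\<close>)
    \<comment> \<open>By \<open>le\<close>, the expected divergence for \<open>Z\<close> minus that
      for \<open>Y\<close> lies in \<open>K\<close>, where \<open>a\<close> is nonnegative.\<close>
    then show "(\<integral>\<omega>. b \<omega> + T \<omega> (X \<omega>) \<partial>M) \<le> 0"
      using a(1)[OF le[unfolded cone_le_def]] by (simp add: inner_diff_right)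
    show "0 \<le> b \<omega> + T \<omega> (Z \<omega>)" if "\<omega> \<in> space M" for \<omega>
      using LZ[OF that] less[of "Z \<omega>" "Y \<omega>"] that assms(12) Y(2)
        linear_0[OF has_derivative_linear[OF g], of "Y \<omega>"]
      by (cases "Z \<omega> = Y \<omega>") auto
  qed
  then show "AE \<omega> in M. Y \<omega> = Z \<omega>"
  proof (rule AE_mp, intro AE_I2 impI)
    fix \<omega> assume "\<omega> \<in> space M" "b \<omega> + T \<omega> (Z \<omega>) = 0"
    then show "Y \<omega> = Z \<omega>"
      using LZ less[of "Z \<omega>" "Y \<omega>"] assms(12) Y(2) by fastforce
  qed
qed

end
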